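(* Suppose that $\gamma|r_i|=|c_i|$ for all $i\in\mathcal S$, for some $\gamma>0$. Let $(|\mathbf R_+|^{-1}\mathbf T_{+-})$ be a nonnegative matrix such that $(|\mathbf R_+|^{-1}\mathbf T_{+-})\mathbf 1=(b+\beta)\mathbf 1$ for some $b,\beta>0$, and let $(|\mathbf R_-|^{-1}\mathbf T_{-+})$ be a nonnegative matrix such that $(|\mathbf R_-|^{-1}\mathbf T_{-+})\mathbf 1=b\mathbf 1$. Assume that, partitioned according to $\mathcal S=\mathcal S_+\cup\mathcal S_-$, $$|\mathbf R|^{-1}\mathbf T=\begin{bmatrix}-(b+\beta)\mathbf I & (|\mathbf R_+|^{-1}\mathbf T_{+-})\\ (|\mathbf R_-|^{-1}\mathbf T_{-+}) & -b\mathbf I\end{bmatrix},$$ and that, with $\lambda=\beta/\gamma$, the initial distribution $\mu=(\mathbf P,\nu)$, $\mathbf P=[\mathbf 0\ \ \mathbf P_-]$, is given by: - $\mathbf P_-\ge\mathbf 0$ with $\mathbf P_-\mathbf 1\le\dfrac{\lambda\gamma}{b+\lambda\gamma}$; - $\nu_+(0)=\mathbf P_-(|\mathbf R_-|^{-1}\mathbf T_{-+})(|\mathbf R_+|^{-1}\mathbf C_+)^{-1}$ and $\nu_+(x)=e^{-\lambda x}\nu_+(0)$ for $x>0$; - $\nu_-(0)\ge\mathbf 0$ with $\nu_-(0)\mathbf 1=\lambda-\dfrac{b+\lambda\gamma}{\gamma}\mathbf P_-\mathbf 1$, and $\nu_-(x)=e^{-\lambda x}\nu_-(0)$ for $x>0$.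 Then the boundary conditions $${}_{D^n}\nu_+(0)={}_{D^n}\mathbf P_-\,(|\mathbf R_-|^{-1}\mathbf T_{-+})(|\mathbf R_+|^{-1}\mathbf C_+)^{-1}$$ are satisfied for all $n\ge0$.
   Context: $\mathcal S$ is a finite set, $\mathbf T=[T_{ij}]_{i,j\in\mathcal S}$ is the generator of an irreducible continuous-time Markov chain on $\mathcal S$, and for each $i\in\mathcal S$ there are nonzero real rates $c_i,r_i$. $\mathcal S_+=\{j:c_j>0\}$, $\mathcal S_-=\{j:c_j<0\}$, so $\mathcal S=\mathcal S_+\cup\mathcal S_-$. $\mathbf R=\mathrm{diag}(r_j)_{j\in\mathcal S}$, $\mathbf R_\pm=\mathrm{diag}(r_j)_{j\in\mathcal S_\pm}$, $\mathbf C_\pm=\mathrm{diag}(c_j)_{j\in\mathcal S_\pm}$; $|\cdot|$ of a diagonal matrix is the entrywise absolute value; $\mathbf T_{+-}=[T_{ij}]_{i\in\mathcal S_+,j\in\mathcal S_-}$, $\mathbf T_{-+}=[T_{ij}]_{i\in\mathcal S_-,j\in\mathcal S_+}$. $\mathbf 1$ is a column vector of ones and $\mathbf I$ an identity matrix of appropriate size. Vectors indexed by $\mathcal S$ are row vectors; subscripts $+,-$ denote restriction to $\mathcal S_+,\mathcal S_-$. A vector of measures $\mu=[\mu_j]_{j\in\mathcal S}$ on $[0,\infty)$ has density $\nu(x)=[\nu_j(x)]_j$ on $x>0$ and point mass $\mathbf P=[P_j]_j$ at $0$: $\mu_j([0,v])=\int_0^v\nu_j(x)dx+P_j$ for $v>0$.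 Values of densities at $0$ denote limits as $x\to0^+$. The operator $D$ acts on such vectors of measures by $$(\mu D)_j([0,v])=\sum_{i\in\mathcal S}\frac{T_{ij}}{|r_i|}\mu_i([0,v])-\frac{c_j}{|r_j|}\nu_j(v),\qquad v>0.$$ For $n\ge0$, ${}_{D^n}\mu=\mu D^n$, with density ${}_{D^n}\nu(x)$ ($x>0$) and atom ${}_{D^n}\mathbf P$ at $0$, i.e. ${}_{D^n}\mu_j([0,v])=\int_0^v{}_{D^n}\nu_j(x)dx+{}_{D^n}P_j$ for all $v>0$ (for $n=0$ these are $\nu$ and $\mathbf P$). *)

theory Defs
  imports "HOL-Analysis.Analysis"
begin

text \<open>
  The phase space is a finite type \<open>'s\<close>. Vectors and matrices indexed by a subset \<open>I\<close> of the
  phases are represented by elements of \<open>real ^ 's\<close> and \<open>real ^ 's ^ 's\<close> that vanish outside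
  \<open>I\<close> (respectively outside \<open>I \<times> J\<close>). The library products \<open>**\<close>, \<open>*v\<close> and \<open>v*\<close> of such
  padded blocks are the padded products of the blocks.
\<close>

definition vec_on :: "'s::finite set \<Rightarrow> real ^ 's \<Rightarrow> real ^ 's" where
  "vec_on I v = (\<chi> j. if j \<in> I then v $ j else 0)"

definition mat_on :: "'s::finite set \<Rightarrow> 's set \<Rightarrow> real ^ 's ^ 's \<Rightarrow> real ^ 's ^ 's" where
  "mat_on I J A = (\<chi> i j. if i \<in> I \<and> j \<in> J then A $ i $ j else 0)"

definition id_on :: "'s::finite set \<Rightarrow> real ^ 's ^ 's" where
  "id_on I = mat_on I I (mat 1)"

definition diag_on :: "'s::finite set \<Rightarrow> real ^ 's \<Rightarrow> real ^ 's ^ 's" where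
  "diag_on I d = (\<chi> i j. if i = j \<and> i \<in> I then d $ i else 0)"

definition abs_mat :: "real ^ 's::finite ^ 's \<Rightarrow> real ^ 's ^ 's" where
  "abs_mat A = (\<chi> i j. \<bar>A $ i $ j\<bar>)"

text \<open>The inverse of a matrix indexed by \<open>I \<times> I\<close>, again as a matrix indexed by \<open>I \<times> I\<close>.\<close>

definition inv_on :: "'s::finite set \<Rightarrow> real ^ 's ^ 's \<Rightarrow> real ^ 's ^ 's" where
  "inv_on I A = (THE B. B = mat_on I I B \<and> A ** B = id_on I \<and> B ** A = id_on I)"

definition phases_pos :: "real ^ 's::finite \<Rightarrow> 's set" where
  "phases_pos c = {j. c $ j > 0}"

definition phases_neg :: "real ^ 's::finite \<Rightarrow> 's set" where
  "phases_neg c = {j. c $ j < 0}"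

definition ctmc_generator :: "real ^ 's::finite ^ 's \<Rightarrow> bool" where
  "ctmc_generator T \<longleftrightarrow> (\<forall>i j. i \<noteq> j \<longrightarrow> T $ i $ j \<ge> 0) \<and> (\<forall>i. (\<Sum>j\<in>UNIV. T $ i $ j) = 0)"

definition irreducible_generator :: "real ^ 's::finite ^ 's \<Rightarrow> bool" where
  "irreducible_generator T \<longleftrightarrow>
     ctmc_generator T \<and> (\<forall>i j. (i, j) \<in> {(k, l). k \<noteq> l \<and> T $ k $ l > 0}\<^sup>*)"

text \<open>\<open>|R\<^sub>I|\<^sup>-\<^sup>1 T\<^sub>I\<^sub>J\<close>\<close>

definition RT_block :: "real ^ 's::finite \<Rightarrow> real ^ 's ^ 's \<Rightarrow> 's set \<Rightarrow> 's set \<Rightarrow> real ^ 's ^ 's" where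
  "RT_block r T I J = inv_on I (abs_mat (diag_on I r)) ** mat_on I J T"

text \<open>\<open>|R\<^sub>I|\<^sup>-\<^sup>1 C\<^sub>I\<close>\<close>

definition RC_block :: "real ^ 's::finite \<Rightarrow> real ^ 's \<Rightarrow> 's set \<Rightarrow> real ^ 's ^ 's" where
  "RC_block r c I = inv_on I (abs_mat (diag_on I r)) ** diag_on I c"

text \<open>
  The vector of (signed) measures on \<open>[0,\<infinity>)\<close> with density \<open>\<nu>\<close> on \<open>(0,\<infinity>)\<close> and atom \<open>P\<close> at \<open>0\<close>;
  values of \<open>\<nu>\<close> on \<open>(-\<infinity>,0]\<close> are irrelevant.
\<close>

definition measure_vec ::
    "(real \<Rightarrow> real ^ 's::finite) \<Rightarrow> real ^ 's \<Rightarrow> real set \<Rightarrow> real ^ 's" where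
  "measure_vec \<nu> P A = (LINT x:A \<inter> {0<..}|lborel. \<nu> x) + indicator A 0 *\<^sub>R P"

text \<open>
  \<open>D_step T r c \<nu> P \<nu>' P'\<close>: the image under \<open>D\<close> of the vector of measures \<open>(\<nu>, P)\<close> is the one with
  density \<open>\<nu>'\<close> and atom \<open>P'\<close>. Here \<open>\<nu>'\<close> is determined almost everywhere only, whereas \<open>\<nu>\<close> enters
  pointwise.
\<close>

definition D_step ::
    "real ^ 's::finite ^ 's \<Rightarrow> real ^ 's \<Rightarrow> real ^ 's \<Rightarrow>
     (real \<Rightarrow> real ^ 's) \<Rightarrow> real ^ 's \<Rightarrow> (real \<Rightarrow> real ^ 's) \<Rightarrow> real ^ 's \<Rightarrow> bool" where
  "D_step T r c \<nu> P \<nu>' P' \<longleftrightarrow>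
     set_integrable lborel {0<..} \<nu> \<and> set_integrable lborel {0<..} \<nu>' \<and>
     (\<forall>j. \<forall>v>0. measure_vec \<nu>' P' {0..v} $ j =
        (\<Sum>i\<in>UNIV. T $ i $ j / \<bar>r $ i\<bar> * measure_vec \<nu> P {0..v} $ i) - c $ j / \<bar>r $ j\<bar> * \<nu> v $ j)"

text \<open>
  \<open>D\<nu> n\<close> and \<open>DP n\<close> are the density and the atom of \<open>\<mu> D\<^sup>n\<close>, where \<open>\<mu> = (\<nu>, P)\<close>. When all
  \<open>c $ j\<close> and \<open>r $ j\<close> are nonzero, the equation for step \<open>n\<close> forces \<open>D\<nu> n\<close> to be continuous on
  \<open>(0,\<infinity>)\<close>, so \<open>DP\<close> and the restriction of each \<open>D\<nu> n\<close> to \<open>(0,\<infinity>)\<close> are uniquely determined.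
\<close>

definition D_iterates ::
    "real ^ 's::finite ^ 's \<Rightarrow> real ^ 's \<Rightarrow> real ^ 's \<Rightarrow> (real \<Rightarrow> real ^ 's) \<Rightarrow> real ^ 's \<Rightarrow>
     (nat \<Rightarrow> real \<Rightarrow> real ^ 's) \<Rightarrow> (nat \<Rightarrow> real ^ 's) \<Rightarrow> bool" where
  "D_iterates T r c \<nu> P D\<nu> DP \<longleftrightarrow>
     D\<nu> 0 = \<nu> \<and> DP 0 = P \<and> (\<forall>n. D_step T r c (D\<nu> n) (DP n) (D\<nu> (Suc n)) (DP (Suc n)))"

end

theory Submission
  imports Defs
begin

text \<open>
  With density \<open>e\<^bsup>-\<lambda>x\<^esup>w\<close> and atom \<open>P\<close>, the operator \<open>D\<close> yields density
  \<open>e\<^bsup>-\<lambda>x\<^esup>w'\<close> and atom \<open>P'\<close>, where \<open>w' = w(M + \<lambda>\<Gamma>)\<close>, \<open>P' = PM - w\<Gamma>\<close>,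
  \<open>M = |R|\<^sup>-\<^sup>1T\<close> and \<open>\<Gamma> = |R|\<^sup>-\<^sup>1C\<close>. Since \<open>\<lambda>\<gamma> = \<beta>\<close>, the block form of \<open>M\<close> makes the pair of conditions
  \<open>P\<^sub>+ = 0\<close>, \<open>\<gamma>w\<^sub>+ = P\<^sub>-L\<close> (with \<open>L = |R\<^sub>-|\<^sup>-\<^sup>1T\<^sub>-\<^sub>+\<close>) invariant under \<open>(P, w) \<mapsto> (P', w')\<close>:
  \<open>P'\<^sub>- = \<gamma>w\<^sub>- - bP\<^sub>-\<close> and \<open>w'\<^sub>+ = w\<^sub>-L - bw\<^sub>+\<close>.
\<close>

section \<open>Diagonal blocks\<close>

lemma diag_on_nth [simp]: "diag_on I d $ i $ j = (if i = j \<and> i \<in> I then d $ i else 0)"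
  by (simp add: diag_on_def)

lemma vec_on_nth [simp]: "vec_on I v $ j = (if j \<in> I then v $ j else 0)"
  by (simp add: vec_on_def)

lemma id_on_eq_diag_on: "id_on I = diag_on I 1"
  by (auto simp: vec_eq_iff id_on_def mat_on_def mat_def)

lemma abs_mat_diag_on: "abs_mat (diag_on I d) = diag_on I (\<chi> i. \<bar>d $ i\<bar>)"
  by (auto simp: vec_eq_iff abs_mat_def)

lemma diag_on_mult_nth: "(diag_on I d ** A) $ i $ j = (if i \<in> I then d $ i * A $ i $ j else 0)"
proof -
  have "(diag_on I d ** A) $ i $ j = (\<Sum>k\<in>UNIV. if k = i then (if i \<in> I then d $ i * A $ i $ j else 0) else 0)"
    unfolding matrix_matrix_mult_def vec_lambda_beta by (rule sum.cong) auto
  then show ?thesis by simp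
qed

lemma vector_diag_on_nth: "(x v* diag_on I d) $ j = (if j \<in> I then x $ j * d $ j else 0)"
  for x d :: "real ^ 's::finite"
proof -
  have "(x v* diag_on I d) $ j = (\<Sum>k\<in>UNIV. if k = j then (if j \<in> I then x $ j * d $ j else 0) else 0)"
    unfolding vector_matrix_mult_def vec_lambda_beta by (rule sum.cong) auto
  then show ?thesis by simp
qed

text \<open>Justifies the \<open>THE\<close> in \<open>inv_on\<close>: \<open>id_on I\<close> is
  neutral for matrices supported in \<open>I \<times> I\<close>, so the usual computation B' =
  B'(AB) = (B'A)B = B applies. The support condition matters, since entries outside
  \<open>I \<times> I\<close> can be invisible to both products.\<close>

lemma inv_on_eqI:
  fixes A B :: "real ^ 'a::finite ^ 'a"
  assumes "B = mat_on I I B" "A ** B = id_on I" "B ** A = id_on I"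
  shows "inv_on I A = B"
  unfolding inv_on_def
proof (rule the_equality)
  fix B' assume B': "B' = mat_on I I B' \<and> A ** B' = id_on I \<and> B' ** A = id_on I"
  have outside: "C $ i $ j = 0" if "C = mat_on I I C" "i \<notin> I \<or> j \<notin> I" for C :: "real ^ 'a ^ 'a" and i j
    using arg_cong[OF that(1), of "\<lambda>A. A $ i $ j"] that(2) by (auto simp: mat_on_def)
  have left: "id_on I ** C = C" if "C = mat_on I I C" for C
    using outside[OF that] by (auto simp: vec_eq_iff id_on_eq_diag_on diag_on_mult_nth)
  have right: "C ** id_on I = C" if "C = mat_on I I C" for C
  proof -
    have "(C ** id_on I) $ i $ j = (C $ i v* diag_on I 1) $ j" for i j
      by (simp add: id_on_eq_diag_on matrix_matrix_mult_def vector_matrix_mult_def)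
    then show ?thesis
      using outside[OF that] by (auto simp: vec_eq_iff vector_diag_on_nth)
  qed
  have "B' = B' ** (A ** B)"
    using right[of B'] B' assms(2) by metis
  also have "\<dots> = (B' ** A) ** B"
    by (rule matrix_mul_assoc)
  also have "\<dots> = B"
    using left[of B] B' assms(1) by metis
  finally show "B' = B" .
qed (use assms in simp)

lemma inv_on_diag_on:
  assumes "\<And>i. i \<in> I \<Longrightarrow> d $ i \<noteq> 0"
  shows "inv_on I (diag_on I d) = diag_on I (\<chi> i. 1 / d $ i)"
  using assms
  by (intro inv_on_eqI) (auto simp: vec_eq_iff mat_on_def id_on_eq_diag_on diag_on_mult_nth)

text \<open>\<open>matrix_inv\<close> is a choice operator, so its value follows from uniqueness of
  two-sided inverses. \<open>block_form\<close> uses it for the full matrix, whereas the blocks use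
  \<open>inv_on\<close>.\<close>

lemma matrix_inv_diag_on_UNIV:
  assumes "\<And>i. d $ i \<noteq> 0"
  shows "matrix_inv (diag_on UNIV d) = diag_on UNIV (\<chi> i. 1 / d $ i)" (is "matrix_inv ?A = ?B")
proof -
  have "?A ** ?B = mat 1 \<and> ?B ** ?A = mat 1"
    using assms by (auto simp: vec_eq_iff diag_on_mult_nth mat_def)
  then have "?A ** matrix_inv ?A = mat 1" "?B ** ?A = mat 1"
    unfolding matrix_inv_def by (metis (mono_tags, lifting) someI_ex)+
  then show ?thesis
    by (metis matrix_mul_assoc matrix_mul_lid matrix_mul_rid)
qed

lemma RT_block_nth:
  assumes "\<And>i. r $ i \<noteq> 0"
  shows "RT_block r T I J $ i $ j = (if i \<in> I \<and> j \<in> J then T $ i $ j / \<bar>r $ i\<bar> else 0)"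
  using assms
  by (simp add: RT_block_def abs_mat_diag_on inv_on_diag_on diag_on_mult_nth mat_on_def)

lemma inv_on_RC_block:
  assumes "\<And>i. r $ i \<noteq> 0" "\<And>i. i \<in> I \<Longrightarrow> c $ i \<noteq> 0"
  shows "inv_on I (RC_block r c I) = diag_on I (\<chi> i. \<bar>r $ i\<bar> / c $ i)"
proof -
  have "RC_block r c I = diag_on I (\<chi> i. c $ i / \<bar>r $ i\<bar>)"
    using assms by (auto simp: RC_block_def abs_mat_diag_on inv_on_diag_on diag_on_mult_nth vec_eq_iff)
  then show ?thesis
    using assms by (subst \<open>RC_block r c I = _\<close>, subst inv_on_diag_on) auto
qed

section \<open>Cumulative distributions\<close>

text \<open>Passes from the Lebesgue integral over \<open>{0<..v}\<close> to the gauge integral over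
  \<open>{0..v}\<close>, to which the rules of calculus apply; the two sets differ by one null
  point.\<close>

lemma measure_vec_Icc:
  assumes "set_integrable lborel {0<..} \<nu>" and "v > 0"
  shows "\<nu> integrable_on {0..v}" and "measure_vec \<nu> P {0..v} = integral {0..v} \<nu> + P"
proof -
  have *: "{0..v} \<inter> {0<..} = {0<..v}" by auto
  have int: "set_integrable lborel {0<..v} \<nu>"
    using assms by (intro set_integrable_subset[OF assms(1)]) auto
  have neg: "negligible {x \<in> {0<..v} - {0..v}. \<nu> x \<noteq> 0}" "negligible {x \<in> {0..v} - {0<..v}. \<nu> x \<noteq> 0}"
    by (auto intro: negligible_subset[of "{0}"])
  show "\<nu> integrable_on {0..v}"
    using integrable_spike_set[OF set_borel_integral_eq_integral(1)[OF int] neg] .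
  show "measure_vec \<nu> P {0..v} = integral {0..v} \<nu> + P"
    using assms(2) integral_spike_set[OF neg]
    by (simp add: measure_vec_def * set_borel_integral_eq_integral(2)[OF int])
qed

lemma measure_vec_cong:
  assumes "\<And>x. x > 0 \<Longrightarrow> \<nu> x = \<nu>' x"
  shows "measure_vec \<nu> P A = measure_vec \<nu>' P A"
proof -
  have "(LINT x:A \<inter> {0<..}|lborel. \<nu> x) = (LINT x:A \<inter> {0<..}|lborel. \<nu>' x)"
    unfolding set_lebesgue_integral_def
    by (rule Bochner_Integration.integral_cong) (auto simp: assms indicator_def)
  then show ?thesis by (simp add: measure_vec_def)
qed

lemma continuous_on_measure_vec:
  assumes "set_integrable lborel {0<..} \<nu>"
  shows "continuous_on {0<..} (\<lambda>v. measure_vec \<nu> P {0..v})"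
proof (rule continuous_at_imp_continuous_on, intro ballI)
  fix v :: real assume "v \<in> {0<..}"
  then have v: "0 < v" "0 < v + 1" by auto
  \<comment> \<open>The indefinite integral is continuous on compact intervals; ending at
    \<open>v + 1\<close> leaves room around \<open>v\<close>.\<close>
  have "continuous_on {0<..<v + 1} (\<lambda>v. integral {0..v} \<nu> + P)"
    using indefinite_integral_continuous_1[OF measure_vec_Icc(1)[OF assms v(2)]]
    by (intro continuous_intros) (auto intro: continuous_on_subset)
  then have "continuous_on {0<..<v + 1} (\<lambda>v. measure_vec \<nu> P {0..v})"
    by (rule continuous_on_eq) (use assms in \<open>simp add: measure_vec_Icc(2)\<close>)
  then show "isCont (\<lambda>v. measure_vec \<nu> P {0..v}) v"
    using v by (simp add: continuous_on_eq_continuous_at)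
qed

text \<open>A cumulative distribution yields its atom as the limit at 0+ and its density as the
  derivative. Continuity turns equality almost everywhere into equality at every positive
  point.\<close>

lemma measure_vec_eqD:
  assumes int: "set_integrable lborel {0<..} \<nu>" "set_integrable lborel {0<..} \<nu>'"
    and cont: "continuous_on {0<..} \<nu>" "continuous_on {0<..} \<nu>'"
    and eq: "\<And>v. v > 0 \<Longrightarrow> measure_vec \<nu> P {0..v} = measure_vec \<nu>' P' {0..v}"
  shows "P = P'" and "x > 0 \<Longrightarrow> \<nu> x = \<nu>' x"
proof -
  have lim: "((\<lambda>v. measure_vec \<mu> Q {0..v}) \<longlongrightarrow> Q) (at_right 0)"
    if "set_integrable lborel {0<..} \<mu>" for \<mu> :: "real \<Rightarrow> real ^ 'a" and Q
  proof -
    have "((\<lambda>v. integral {0..v} \<mu>) \<longlongrightarrow> integral {0..0} \<mu>) (at 0 within {0..1})"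
      using indefinite_integral_continuous_1[OF measure_vec_Icc(1)[OF that, of 1]]
      unfolding continuous_on_def by (rule bspec[where x = "0 :: real", THEN tendsto_eq_rhs]) auto
    then have "((\<lambda>v. integral {0..v} \<mu> + Q) \<longlongrightarrow> 0 + Q) (at_right 0)"
      by (intro tendsto_intros) (simp add: at_within_Icc_at_right)
    then have "((\<lambda>v. integral {0..v} \<mu> + Q) \<longlongrightarrow> Q) (at_right 0)"
      by simp
    then show ?thesis
      by (rule Lim_transform_eventually)
        (use that in \<open>auto simp: eventually_at_filter measure_vec_Icc(2)\<close>)
  qed
  have "((\<lambda>v. measure_vec \<nu> P {0..v}) \<longlongrightarrow> P') (at_right 0)"
    by (rule Lim_transform_eventually[OF lim[OF int(2)]]) (auto simp: eventually_at_filter eq)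
  then show "P = P'"
    using lim[OF int(1)] tendsto_unique trivial_limit_at_right_real by blast
  assume x: "x > 0"
  have der: "((\<lambda>v. measure_vec \<mu> Q {0..v}) has_vector_derivative \<mu> x) (at x)"
    if "set_integrable lborel {0<..} \<mu>" "continuous_on {0<..} \<mu>" for \<mu> :: "real \<Rightarrow> real ^ 'a" and Q
  proof -
    have "isCont \<mu> x"
      using that x by (simp add: continuous_on_eq_continuous_at)
    \<comment> \<open>The subtracted \<open>{}\<close> is the exceptional set of the integral rule.
      As \<open>x\<close> is interior to \<open>{0..x + 1}\<close>, the derivative is
      two-sided.\<close>
    then have "((\<lambda>u. integral {0..u} \<mu>) has_vector_derivative \<mu> x) (at x within {0..x + 1} - {})"
      using x that measure_vec_Icc(1)[OF that(1), of "x + 1"]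
      by (intro integral_has_vector_derivative_continuous_at)
        (auto intro: continuous_at_imp_continuous_at_within)
    then have "((\<lambda>u. integral {0..u} \<mu> + Q) has_vector_derivative \<mu> x + 0) (at x)"
      using x by (intro derivative_intros) (simp add: at_within_Icc_at)
    then have "((\<lambda>u. integral {0..u} \<mu> + Q) has_vector_derivative \<mu> x) (at x)"
      by simp
    then show ?thesis
      by (rule has_vector_derivative_transform_within_open[where S = "{0<..}"])
        (use that x in \<open>auto simp: measure_vec_Icc(2)\<close>)
  qed
  have "((\<lambda>v. measure_vec \<nu> P {0..v}) has_vector_derivative \<nu>' x) (at x)"
    by (rule has_vector_derivative_transform_within_open[OF der[OF int(2) cont(2)], where S = "{0<..}"])
      (use x eq in auto)
  then show "\<nu> x = \<nu>' x"
    using der[OF int(1) cont(1)] vector_derivative_unique_at by blast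
qed

lemma set_integrable_exp_scaleR:
  fixes w :: "real ^ 's::finite"
  assumes "lam > 0"
  shows "set_integrable lborel {0<..} (\<lambda>x. exp (- lam * x) *\<^sub>R w)"
proof -
  have "(\<lambda>x. exp (- lam * x)) absolutely_integrable_on {0..}"
    using integrable_on_exp_minus_to_infinity[OF assms, of 0]
    by (intro nonnegative_absolutely_integrable_1) auto
  \<comment> \<open>\<open>absolutely_integrable_on\<close> refers to the completed measure; Borel
    measurability of the integrand leads back to \<open>lborel\<close>.\<close>
  then have "set_integrable lborel {0..} (\<lambda>x. exp (- lam * x))"
    by (auto simp: set_integrable_def integrable_completion)
  then show ?thesis
    unfolding set_integrable_def
    using integrable_scaleR_left[of w lborel "\<lambda>x. indicator {0<..} x *\<^sub>R exp (- lam * x)"]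
      set_integrable_subset[of lborel "{0..}" "\<lambda>x. exp (- lam * x)" "{0<..}"]
    by (auto simp: set_integrable_def subset_eq)
qed

lemma measure_vec_exp:
  assumes "lam > 0" "v > 0"
  shows "measure_vec (\<lambda>x. exp (- lam * x) *\<^sub>R w) P {0..v} = ((1 - exp (- lam * v)) / lam) *\<^sub>R w + P"
proof -
  have "((\<lambda>x. exp (- lam * x) *\<^sub>R w) has_integral
      (- exp (- lam * v) / lam) *\<^sub>R w - (- exp (- lam * 0) / lam) *\<^sub>R w) {0..v}"
    using assms by (intro fundamental_theorem_of_calculus)
      (auto intro!: derivative_eq_intros simp: has_vector_derivative_def fun_eq_iff field_simps)
  then have "((\<lambda>x. exp (- lam * x) *\<^sub>R w) has_integral ((1 - exp (- lam * v)) / lam) *\<^sub>R w) {0..v}"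
    by (rule has_integral_eq_rhs) (simp flip: scaleR_left.diff add: diff_divide_distrib)
  then show ?thesis
    unfolding measure_vec_Icc(2)[OF set_integrable_exp_scaleR[OF assms(1)] assms(2)]
    by (simp only: integral_unique)
qed

section \<open>Uniqueness of the iterates\<close>

text \<open>The input density is evaluated only at v > 0 and integrated only over
  \<open>{0<..}\<close>. This absorbs the arbitrary values of densities at nonpositive
  arguments.\<close>

lemma D_step_cong:
  assumes "\<And>x. x > 0 \<Longrightarrow> \<nu>1 x = \<nu>2 x"
  shows "D_step T r c \<nu>1 P \<nu>' P' \<longleftrightarrow> D_step T r c \<nu>2 P \<nu>' P'"
proof -
  have "set_integrable lborel {0<..} \<nu>1 \<longleftrightarrow> set_integrable lborel {0<..} \<nu>2"
    by (rule set_integrable_cong) (auto simp: assms)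
  then show ?thesis
    using assms measure_vec_cong[of \<nu>1 \<nu>2 P, OF assms] by (auto simp: D_step_def)
qed

text \<open>As c_j is nonzero, the defining equation can be solved for the j-th density at v in
  terms of cumulative distributions, which are continuous in v.\<close>

lemma D_step_continuous_on:
  assumes D: "D_step T r c \<nu> P \<nu>' P'" and "\<And>i. c $ i \<noteq> 0" "\<And>i. r $ i \<noteq> 0"
  shows "continuous_on {0<..} \<nu>"
proof -
  have int: "set_integrable lborel {0<..} \<nu>" "set_integrable lborel {0<..} \<nu>'"
    using D by (auto simp: D_step_def)
  have "continuous_on {0<..} (\<lambda>v. \<nu> v $ j)" for j
  proof -
    have eq: "((\<Sum>i\<in>UNIV. T $ i $ j / \<bar>r $ i\<bar> * measure_vec \<nu> P {0..v} $ i)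
        - measure_vec \<nu>' P' {0..v} $ j) * \<bar>r $ j\<bar> / c $ j = \<nu> v $ j" if "v \<in> {0<..}" for v
      using D that assms by (simp add: D_step_def)
    show ?thesis
      by (rule continuous_on_eq[OF _ eq])
        (intro continuous_intros continuous_on_measure_vec int, auto simp: assms)
  qed
  then show ?thesis
    by (subst continuous_on_componentwise) (auto simp: Basis_vec_def inner_axis)
qed

text \<open>The step into stage n+1 fixes its density only almost everywhere; the step out of that
  stage makes the density continuous, hence unique on positive arguments. The induction uses both
  steps.\<close>

lemma D_iterates_unique:
  assumes D1: "D_iterates T r c \<nu> P D\<nu>1 DP1" and D2: "D_iterates T r c \<nu> P D\<nu>2 DP2"
    and nz: "\<And>i. c $ i \<noteq> 0" "\<And>i. r $ i \<noteq> 0"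
  shows "DP1 n = DP2 n \<and> (\<forall>x>0. D\<nu>1 n x = D\<nu>2 n x)"
proof (induction n)
  case 0
  then show ?case using D1 D2 by (simp add: D_iterates_def)
next
  case (Suc n)
  have step: "D_step T r c (D\<nu>1 k) (DP1 k) (D\<nu>1 (Suc k)) (DP1 (Suc k))"
    "D_step T r c (D\<nu>2 k) (DP2 k) (D\<nu>2 (Suc k)) (DP2 (Suc k))" for k
    using D1 D2 by (auto simp: D_iterates_def)
  \<comment> \<open>By the induction hypothesis the second step may start from the data of the
    first, so both images share one right-hand side.\<close>
  have step2: "D_step T r c (D\<nu>1 n) (DP1 n) (D\<nu>2 (Suc n)) (DP2 (Suc n))"
    using step(2)[of n] Suc D_step_cong[of "D\<nu>1 n" "D\<nu>2 n"] by simp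
  have eq: "measure_vec (D\<nu>1 (Suc n)) (DP1 (Suc n)) {0..v} = measure_vec (D\<nu>2 (Suc n)) (DP2 (Suc n)) {0..v}"
    if "v > 0" for v
    using step(1)[of n] step2 that by (simp add: D_step_def vec_eq_iff)
  have int: "set_integrable lborel {0<..} (D\<nu>1 (Suc n))" "set_integrable lborel {0<..} (D\<nu>2 (Suc n))"
    using step[of n] by (auto simp: D_step_def)
  show ?case
    using measure_vec_eqD[OF int D_step_continuous_on[OF step(1) nz] D_step_continuous_on[OF step(2) nz] eq]
    by blast
qed

section \<open>The operator on exponential densities\<close>

definition scaled_gen :: "real ^ 's::finite ^ 's \<Rightarrow> real ^ 's \<Rightarrow> real ^ 's ^ 's" where
  "scaled_gen T r = (\<chi> i j. T $ i $ j / \<bar>r $ i\<bar>)"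

definition exp_atom ::
    "real ^ 's::finite ^ 's \<Rightarrow> real ^ 's \<Rightarrow> real ^ 's \<Rightarrow> real ^ 's \<Rightarrow> real ^ 's \<Rightarrow> real ^ 's" where
  "exp_atom T r c P w = (\<chi> j. (P v* scaled_gen T r) $ j - c $ j / \<bar>r $ j\<bar> * w $ j)"

definition exp_weight ::
    "real ^ 's::finite ^ 's \<Rightarrow> real ^ 's \<Rightarrow> real ^ 's \<Rightarrow> real \<Rightarrow> real ^ 's \<Rightarrow> real ^ 's" where
  "exp_weight T r c lam w = (\<chi> j. (w v* scaled_gen T r) $ j + lam * (c $ j / \<bar>r $ j\<bar>) * w $ j)"

lemma scaled_gen_eq_matrix_inv:
  assumes "\<And>i. r $ i \<noteq> 0"
  shows "scaled_gen T r = matrix_inv (abs_mat (diag_on UNIV r)) ** T"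
  using assms
  by (simp add: abs_mat_diag_on matrix_inv_diag_on_UNIV vec_eq_iff diag_on_mult_nth scaled_gen_def)

text \<open>With s = (1 - exp(-lam v)) / lam, both sides of the equation are affine in s, because
  exp(-lam v) = 1 - lam s. Comparing constant terms gives \<open>exp_atom\<close>, comparing
  coefficients of s gives \<open>exp_weight\<close>.\<close>

lemma D_step_exp:
  assumes lam: "lam > 0"
  shows "D_step T r c (\<lambda>x. exp (- lam * x) *\<^sub>R w) P
    (\<lambda>x. exp (- lam * x) *\<^sub>R exp_weight T r c lam w) (exp_atom T r c P w)"
  unfolding D_step_def
proof (intro conjI allI impI set_integrable_exp_scaleR[OF lam])
  fix j and v :: real assume v: "v > 0"
  define s where "s = (1 - exp (- lam * v)) / lam"
  have s: "exp (- lam * v) = 1 - lam * s" using lam by (simp add: s_def)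
  have sum_eq: "(\<Sum>i\<in>UNIV. T $ i $ j / \<bar>r $ i\<bar> * (s *\<^sub>R w + P) $ i) =
      s * (w v* scaled_gen T r) $ j + (P v* scaled_gen T r) $ j"
    by (simp add: vector_matrix_mult_def scaled_gen_def sum_distrib_left ring_distribs add_divide_distrib sum.distrib mult_ac)
  show "measure_vec (\<lambda>x. exp (- lam * x) *\<^sub>R exp_weight T r c lam w) (exp_atom T r c P w) {0..v} $ j =
      (\<Sum>i\<in>UNIV. T $ i $ j / \<bar>r $ i\<bar> * measure_vec (\<lambda>x. exp (- lam * x) *\<^sub>R w) P {0..v} $ i)
      - c $ j / \<bar>r $ j\<bar> * (exp (- lam * v) *\<^sub>R w) $ j"
    unfolding measure_vec_exp[OF lam v] s_def[symmetric]
    unfolding sum_eq s by (simp add: exp_weight_def exp_atom_def algebra_simps)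
qed

section \<open>Preservation of the boundary condition along the iterates\<close>

theorem theorem2:
  fixes T :: "real ^ 's::finite ^ 's"
    and c r P \<nu>0 :: "real ^ 's"
    and \<nu> :: "real \<Rightarrow> real ^ 's"
    and \<gamma> b \<beta> lam :: real
    and Sp Sm :: "'s set"
  assumes generator: "irreducible_generator T"
    and c_nonzero: "\<And>i. c $ i \<noteq> 0"
    and r_nonzero: "\<And>i. r $ i \<noteq> 0"
    and Sp: "Sp = phases_pos c"
    and Sm: "Sm = phases_neg c"
    and gamma_pos: "\<gamma> > 0"
    and gamma_rates: "\<And>i. \<gamma> * \<bar>r $ i\<bar> = \<bar>c $ i\<bar>"
    and b_pos: "b > 0"
    and beta_pos: "\<beta> > 0"
    and up_nonneg: "0 \<le> RT_block r T Sp Sm"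
    and up_row_sums: "RT_block r T Sp Sm *v vec_on Sm 1 = (b + \<beta>) *\<^sub>R vec_on Sp 1"
    and down_nonneg: "0 \<le> RT_block r T Sm Sp"
    and down_row_sums: "RT_block r T Sm Sp *v vec_on Sp 1 = b *\<^sub>R vec_on Sm 1"
    and block_form: "matrix_inv (abs_mat (diag_on UNIV r)) ** T =
          (- (b + \<beta>)) *\<^sub>R id_on Sp + RT_block r T Sp Sm +
          RT_block r T Sm Sp + (- b) *\<^sub>R id_on Sm"
    and lambda: "lam = \<beta> / \<gamma>"
    and P_plus: "vec_on Sp P = 0"
    and P_minus_nonneg: "0 \<le> vec_on Sm P"
    and P_minus_mass: "vec_on Sm P \<bullet> 1 \<le> lam * \<gamma> / (b + lam * \<gamma>)"
    and density_at_0: "(\<nu> \<longlongrightarrow> \<nu>0) (at_right 0)"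
    and density_plus_0: "vec_on Sp \<nu>0 = vec_on Sm P v* RT_block r T Sm Sp v* inv_on Sp (RC_block r c Sp)"
    and density_plus: "\<And>x. x > 0 \<Longrightarrow> vec_on Sp (\<nu> x) = exp (- lam * x) *\<^sub>R vec_on Sp \<nu>0"
    and density_minus_0_nonneg: "0 \<le> vec_on Sm \<nu>0"
    and density_minus_0_mass: "vec_on Sm \<nu>0 \<bullet> 1 = lam - (b + lam * \<gamma>) / \<gamma> * (vec_on Sm P \<bullet> 1)"
    and density_minus: "\<And>x. x > 0 \<Longrightarrow> vec_on Sm (\<nu> x) = exp (- lam * x) *\<^sub>R vec_on Sm \<nu>0"
  shows "(\<exists>D\<nu> DP. D_iterates T r c \<nu> P D\<nu> DP) \<and>
         (\<forall>D\<nu> DP. D_iterates T r c \<nu> P D\<nu> DP \<longrightarrow>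
           (\<forall>n. ((\<lambda>x. vec_on Sp (D\<nu> n x)) \<longlongrightarrow>
                  vec_on Sm (DP n) v* RT_block r T Sm Sp v* inv_on Sp (RC_block r c Sp)) (at_right 0)))"
proof -
  let ?L = "RT_block r T Sm Sp"
  let ?Ci = "inv_on Sp (RC_block r c Sp)"
  have lam: "lam > 0" and lam_gamma: "lam * \<gamma> = \<beta>"
    using lambda gamma_pos beta_pos by auto
  have part: "i \<in> Sm \<longleftrightarrow> i \<notin> Sp" for i
    using c_nonzero[of i] by (auto simp: Sp Sm phases_pos_def phases_neg_def)
  \<comment> \<open>\<open>gamma_rates\<close> fixes this quotient up to the sign of c_i, so |R|^-1
    C is a scalar matrix on each of the two blocks.\<close>
  have rate: "c $ i / \<bar>r $ i\<bar> = (if i \<in> Sp then \<gamma> else - \<gamma>)" for i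
    using gamma_rates[of i] c_nonzero[of i] r_nonzero[of i]
    by (auto simp: Sp phases_pos_def field_simps abs_if split: if_splits)
  have Ci: "(x v* ?Ci) $ j = (if j \<in> Sp then x $ j / \<gamma> else 0)" for x :: "real ^ 's" and j
    using rate[of j] r_nonzero[of j] c_nonzero[of j] gamma_pos
    by (simp add: inv_on_RC_block r_nonzero c_nonzero vector_diag_on_nth field_simps)
  have \<nu>: "\<nu> x = exp (- lam * x) *\<^sub>R \<nu>0" if "x > 0" for x
    using density_plus[OF that] density_minus[OF that] part
    by (auto simp: vec_eq_iff split: if_splits)
  \<comment> \<open>Atom and weight are iterated as a pair because the new atom depends on
    both.\<close>
  define step where "step = (\<lambda>(P, w). (exp_atom T r c P w, exp_weight T r c lam w))"
  define Pn wn where "Pn n = fst ((step ^^ n) (P, \<nu>0))" and "wn n = snd ((step ^^ n) (P, \<nu>0))" for n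
  have rec: "Pn 0 = P" "wn 0 = \<nu>0" "Pn (Suc n) = exp_atom T r c (Pn n) (wn n)"
    "wn (Suc n) = exp_weight T r c lam (wn n)" for n
    by (simp_all add: Pn_def wn_def step_def case_prod_unfold)
  \<comment> \<open>\<open>D_iterates\<close> demands \<open>\<nu>\<close> itself as entry 0; it is
    known to be exponential on positive arguments only.\<close>
  define E where "E n = (if n = 0 then \<nu> else (\<lambda>x. exp (- lam * x) *\<^sub>R wn n))" for n
  have E: "E n x = exp (- lam * x) *\<^sub>R wn n" if "x > 0" for n x
    using that \<nu> by (simp add: E_def rec)
  have iter: "D_iterates T r c \<nu> P E Pn"
    unfolding D_iterates_def
  proof (intro conjI allI)
    fix n
    have "D_step T r c (E n) (Pn n) (\<lambda>x. exp (- lam * x) *\<^sub>R wn (Suc n)) (Pn (Suc n))"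
      using D_step_exp[OF lam, of T r c "wn n" "Pn n"] E[of _ n]
        D_step_cong[of "E n" "\<lambda>x. exp (- lam * x) *\<^sub>R wn n"]
      by (simp add: rec)
    then show "D_step T r c (E n) (Pn n) (E (Suc n)) (Pn (Suc n))"
      by (simp add: E_def)
  qed (simp_all add: E_def rec)

  have gen_diag: "scaled_gen T r $ i $ i = (if i \<in> Sp then - (b + \<beta>) else - b)"
    and gen_off: "i \<noteq> j \<Longrightarrow> i \<in> Sp \<longleftrightarrow> j \<in> Sp \<Longrightarrow> scaled_gen T r $ i $ j = 0" for i j
    unfolding scaled_gen_eq_matrix_inv[OF r_nonzero] block_form
    by (simp_all add: id_on_eq_diag_on RT_block_nth r_nonzero part)
  have L_nth: "?L $ i $ j = (if i \<notin> Sp \<and> j \<in> Sp then scaled_gen T r $ i $ j else 0)" for i j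
    by (simp add: RT_block_nth r_nonzero part scaled_gen_def)
  \<comment> \<open>In a column of \<open>Sp\<close>, off-diagonal entries within the block vanish,
    which leaves the diagonal entry and the block \<open>?L\<close>.\<close>
  have gen_plus: "(x v* scaled_gen T r) $ j = (x v* ?L) $ j - (b + \<beta>) * x $ j"
    if "j \<in> Sp" for x :: "real ^ 's" and j
  proof -
    have "x $ i * scaled_gen T r $ i $ j =
        x $ i * ?L $ i $ j + (if i = j then - (b + \<beta>) * x $ j else 0)" for i
      using gen_diag[of j] gen_off[of i j] that
      by (cases "i = j"; cases "i \<in> Sp") (auto simp: L_nth)
    then show ?thesis
      by (simp add: sum.distrib vector_matrix_mult_def left_diff_distrib distrib_right)
  qed
  \<comment> \<open>In a column of \<open>Sm\<close>, the off-diagonal entries that may be nonzero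
    lie in rows of \<open>Sp\<close>, where \<open>x\<close> vanishes.\<close>
  have gen_minus: "(x v* scaled_gen T r) $ j = - b * x $ j"
    if "j \<in> Sm" and "vec_on Sp x = 0" for x :: "real ^ 's" and j
  proof -
    have "x $ i = 0" if "i \<in> Sp" for i
      using \<open>vec_on Sp x = 0\<close> that by (auto simp: vec_eq_iff split: if_splits)
    then have "x $ i * scaled_gen T r $ i $ j = (if i = j then - b * x $ j else 0)" for i
      using gen_diag[of j] gen_off[of i j] \<open>j \<in> Sm\<close> part
      by (cases "i = j"; cases "i \<in> Sp") auto
    then show ?thesis
      by (simp add: vector_matrix_mult_def)
  qed
  have L_minus: "vec_on Sm x v* ?L = x v* ?L" for x :: "real ^ 's"
    by (auto simp: vec_eq_iff vector_matrix_mult_def RT_block_nth r_nonzero intro!: sum.cong)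

  \<comment> \<open>The boundary condition, multiplied by \<gamma> to clear the inverse, is carried
    together with the vanishing of the atom on \<open>Sp\<close>, which is what lets
    \<open>gen_minus\<close> apply to \<open>Pn n\<close>.\<close>
  have inv: "vec_on Sp (Pn n) = 0 \<and> \<gamma> *\<^sub>R vec_on Sp (wn n) = vec_on Sp (Pn n v* ?L)" for n
  proof (induction n)
    case 0
    have "\<gamma> * \<nu>0 $ j = (P v* ?L) $ j" if "j \<in> Sp" for j
      using arg_cong[OF density_plus_0, of "\<lambda>v. v $ j"] that gamma_pos
      by (simp add: Ci L_minus field_simps)
    then show ?case
      using P_plus by (simp add: rec vec_eq_iff)
  next
    case (Suc n)
    have w: "\<gamma> * wn n $ j = (Pn n v* ?L) $ j" and P0: "Pn n $ j = 0" if "j \<in> Sp" for j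
      using Suc that by (auto simp: vec_eq_iff split: if_splits)
    have atom: "vec_on Sm (Pn (Suc n)) = vec_on Sm (\<gamma> *\<^sub>R wn n - b *\<^sub>R Pn n)"
      using Suc part by (simp add: vec_eq_iff rec exp_atom_def rate gen_minus)
    \<comment> \<open>Rows of \<open>?L\<close> outside \<open>Sm\<close> are zero, so the equality
      on \<open>Sm\<close> suffices.\<close>
    have "Pn (Suc n) v* ?L = \<gamma> *\<^sub>R (wn n v* ?L) - b *\<^sub>R (Pn n v* ?L)"
      using atom L_minus[of "Pn (Suc n)"] L_minus[of "\<gamma> *\<^sub>R wn n - b *\<^sub>R Pn n"]
      by (simp add: vector_matrix_mult_diff_distrib scaleR_vector_matrix_assoc)
    then have L_atom: "(Pn (Suc n) v* ?L) $ j = \<gamma> * (wn n v* ?L) $ j - b * (Pn n v* ?L) $ j" for j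
      by simp
    have "\<gamma> * wn (Suc n) $ j = (Pn (Suc n) v* ?L) $ j" if "j \<in> Sp" for j
    proof -
      \<comment> \<open>Here the choice of the decay rate enters: -(b + \<beta>) + lam \<gamma> =
        -b.\<close>
      have "wn (Suc n) $ j = (wn n v* ?L) $ j - b * wn n $ j"
        using that by (simp add: rec exp_weight_def gen_plus rate algebra_simps flip: lam_gamma)
      then show ?thesis
        using w[OF that] by (simp add: L_atom right_diff_distrib mult.left_commute)
    qed
    \<comment> \<open>The inflow through \<open>?L\<close> is balanced exactly by \<gamma> times the
      weight, and the diagonal term vanishes with \<open>Pn n $ j\<close>.\<close>
    moreover have "Pn (Suc n) $ j = 0" if "j \<in> Sp" for j
      using w[OF that] P0[OF that] that by (simp add: rec exp_atom_def gen_plus rate)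
    ultimately show ?case
      by (simp add: vec_eq_iff)
  qed
  have bc: "vec_on Sm (Pn n) v* ?L v* ?Ci = vec_on Sp (wn n)" for n
    using inv[of n] gamma_pos by (auto simp: vec_eq_iff Ci L_minus field_simps split: if_splits)
  show ?thesis
  proof (intro conjI exI allI impI)
    show "D_iterates T r c \<nu> P E Pn" by (rule iter)
  next
    fix D\<nu> DP n assume D: "D_iterates T r c \<nu> P D\<nu> DP"
    \<comment> \<open>Any sequence of iterates agrees with the explicit one on positive arguments,
      so its limit at 0+ on \<open>Sp\<close> is that of exp(-lam x) times
      \<open>wn n\<close>.\<close>
    note u = D_iterates_unique[OF D iter c_nonzero r_nonzero, of n]
    have "((\<lambda>x. exp (- lam * x) *\<^sub>R vec_on Sp (wn n)) \<longlongrightarrow> exp (- lam * 0) *\<^sub>R vec_on Sp (wn n)) (at_right 0)"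
      by (intro tendsto_intros)
    then have "((\<lambda>x. vec_on Sp (D\<nu> n x)) \<longlongrightarrow> exp (- lam * 0) *\<^sub>R vec_on Sp (wn n)) (at_right 0)"
      by (rule Lim_transform_eventually)
        (use u E in \<open>auto simp: eventually_at_filter vec_eq_iff\<close>)
    then show "((\<lambda>x. vec_on Sp (D\<nu> n x)) \<longlongrightarrow> vec_on Sm (DP n) v* ?L v* ?Ci) (at_right 0)"
      using u by (simp add: bc)
  qed
qed

end
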